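(* Let $X$ be a Hilbert space with a continuous filtration $\{X_t\}_{t\in[t_0,T]}$ (where $t_0<T$ are real numbers), and corresponding orthogonal projections $\{\pi_t\}_{t\in[t_0,T]}$. Let $K\colon X\times X\to\mathcal{L}(X)$ be an operator-valued kernel and $H$ its reproducing kernel Hilbert space. Let $\varrho\colon H\times X\to X$, $(f,x)\mapsto f(x)$, be the application map. Assume that: (i) the distance induced by $K$ is bounded by a multiple of the norm-induced distance on $X$, i.e. there is $\lambda>0$ such that for all $x_1,x_2\in X$ $$\lVert K(x_1,x_1)+K(x_2,x_2)-2K(x_1,x_2)\rVert_{\mathcal{L}(X)}\le\lambda^2\lVert x_1-x_2\rVert_X^2;$$ (ii) for all $t\in[t_0,T]$ and all $x_1,x_2\in X$, $$K(x_1,x_2)\,\pi_t=\pi_t\,K(x_1,x_2)=\pi_t\,K(\pi_tx_1,\pi_tx_2).$$ Then $\varrho$ is a parametric machine, that is to say, $K$ is a kernel machine.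
   Context: A filtration $\{X_t\}_{t\in[t_0,T]}$ of $X$ is a family of closed subspaces with $X_s\subseteq X_t$ for $s\le t$, $X_{t_0}=0$ and $X_T=X$; $\pi_t$ is the orthogonal projection of $X$ onto $X_t$. The filtration is continuous if, for all $x\in X$, the function $[t_0,T]\to X$, $t\mapsto\pi_t(x)$, is continuous with respect to the norm on $X$. $\mathcal{L}(X)$ is the Banach space of bounded linear endomorphisms of $X$ with the operator norm. A map $K\colon X\times X\to\mathcal{L}(X)$ is an operator-valued kernel if (1) for all $x_1,x_2\in X$ the operator $K(x_1,x_2)$ is self-adjoint, and (2) for all $x_1,\dots,x_n\in X$ and $c_1,\dots,c_n\in X$ the matrix $M_{i,j}=\langle c_i,K(x_i,x_j)c_j\rangle$ is positive-semidefinite. Its reproducing kernel Hilbert space $H$ is the Hilbert space of functions $X\to X$ that contains all functions $K(\cdot,x)c$ and satisfies $\langle f,K(\cdot,x)c\rangle_H=\langle f(x),c\rangle_X$ for all $f\in H$, $x,c\in X$. A continuous (not necessarily linear) map $f\colon M\to M$ on a topological vector space $M$ is a machine if, for every topological space $Z$ and every continuous map $g\colon Z\to M$, there exists a unique continuous map $h\colon Z\to M$ such that $h=g+f\circ h$; this $h$ is the stable state of $f$ with initial condition $g$. Given a topological space $P$ (parameter space), a parametric machine is a continuous map $P\times M\to M$, $(p,m)\mapsto f_p(m)$, such that each $f_p$ is a machine and such that, given any (jointly) continuous family of input functions $g_p(m)$, the family of stable states $h_p(m)$ (with $h_p$ the stable state of $f_p$ with initial condition $g_p$) is also jointly continuous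 in $p$ and $m$. The kernel $K$ is a kernel machine if the map $H\times X\to X$, $(f,x)\mapsto f(x)$, is a parametric machine with parameter space $H$ (norm topologies on $H$ and $X$). *)

theory Defs
  imports "HOL-Analysis.Analysis"
begin

section \<open>Filtrations\<close>

definition filtration :: "real \<Rightarrow> real \<Rightarrow> (real \<Rightarrow> 'x::real_inner set) \<Rightarrow> bool" where
  "filtration t0 T F \<longleftrightarrow>
     (\<forall>t\<in>{t0..T}. subspace (F t) \<and> closed (F t)) \<and>
     (\<forall>s\<in>{t0..T}. \<forall>t\<in>{t0..T}. s \<le> t \<longrightarrow> F s \<subseteq> F t) \<and>
     F t0 = {0} \<and> F T = UNIV"

definition is_orthogonal_projection ::
    "'x::real_inner set \<Rightarrow> ('x \<Rightarrow>\<^sub>L 'x) \<Rightarrow> bool" where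
  "is_orthogonal_projection S p \<longleftrightarrow>
     (\<forall>x. p x \<in> S \<and> (\<forall>y\<in>S. orthogonal (x - p x) y))"

definition filtration_projections ::
    "real \<Rightarrow> real \<Rightarrow> (real \<Rightarrow> 'x::real_inner set) \<Rightarrow> (real \<Rightarrow> 'x \<Rightarrow>\<^sub>L 'x) \<Rightarrow> bool" where
  "filtration_projections t0 T F \<pi> \<longleftrightarrow>
     (\<forall>t\<in>{t0..T}. is_orthogonal_projection (F t) (\<pi> t))"

definition continuous_filtration ::
    "real \<Rightarrow> real \<Rightarrow> (real \<Rightarrow> 'x::real_inner set) \<Rightarrow> (real \<Rightarrow> 'x \<Rightarrow>\<^sub>L 'x) \<Rightarrow> bool" where
  "continuous_filtration t0 T F \<pi> \<longleftrightarrow>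
     filtration t0 T F \<and> filtration_projections t0 T F \<pi> \<and>
     (\<forall>x. continuous_on {t0..T} (\<lambda>t. \<pi> t x))"

section \<open>Operator-valued kernels\<close>

definition self_adjoint :: "('x::real_inner \<Rightarrow>\<^sub>L 'x) \<Rightarrow> bool" where
  "self_adjoint A \<longleftrightarrow> (\<forall>v w. inner (A v) w = inner v (A w))"

(* Real matrices; as usual over the reals, symmetry is part of the notion. *)
definition pos_semidef_matrix :: "nat \<Rightarrow> (nat \<Rightarrow> nat \<Rightarrow> real) \<Rightarrow> bool" where
  "pos_semidef_matrix n M \<longleftrightarrow>
     (\<forall>i<n. \<forall>j<n. M i j = M j i) \<and>
     (\<forall>a :: nat \<Rightarrow> real. 0 \<le> (\<Sum>i<n. \<Sum>j<n. a i * M i j * a j))"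

definition operator_valued_kernel ::
    "('x::real_inner \<Rightarrow> 'x \<Rightarrow> 'x \<Rightarrow>\<^sub>L 'x) \<Rightarrow> bool" where
  "operator_valued_kernel K \<longleftrightarrow>
     (\<forall>x1 x2. self_adjoint (K x1 x2)) \<and>
     (\<forall>n (x :: nat \<Rightarrow> 'x) (c :: nat \<Rightarrow> 'x).
        pos_semidef_matrix n (\<lambda>i j. inner (c i) (K (x i) (x j) (c j))))"

section \<open>Reproducing kernel Hilbert spaces\<close>

(* A Hilbert space of functions is a carrier set H of functions, with pointwise
   vector space operations, together with an inner product ip; the values of ip
   outside H are irrelevant. *)

(* Metric_space demands nonnegativity and symmetry also off the carrier,
   hence the default value 0 there. *)
definition ip_dist ::
    "('a \<Rightarrow> 'b::real_vector) set \<Rightarrow> (('a \<Rightarrow> 'b) \<Rightarrow> ('a \<Rightarrow> 'b) \<Rightarrow> real) \<Rightarrow>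
     ('a \<Rightarrow> 'b) \<Rightarrow> ('a \<Rightarrow> 'b) \<Rightarrow> real" where
  "ip_dist H ip f g =
     (if f \<in> H \<and> g \<in> H then sqrt (ip (\<lambda>x. f x - g x) (\<lambda>x. f x - g x)) else 0)"

definition inner_product_function_space ::
    "('a \<Rightarrow> 'b::real_vector) set \<Rightarrow> (('a \<Rightarrow> 'b) \<Rightarrow> ('a \<Rightarrow> 'b) \<Rightarrow> real) \<Rightarrow> bool" where
  "inner_product_function_space H ip \<longleftrightarrow>
     (\<lambda>x. 0) \<in> H \<and>
     (\<forall>f\<in>H. \<forall>g\<in>H. (\<lambda>x. f x + g x) \<in> H) \<and>
     (\<forall>a. \<forall>f\<in>H. (\<lambda>x. a *\<^sub>R f x) \<in> H) \<and>
     (\<forall>f\<in>H. \<forall>g\<in>H. ip f g = ip g f) \<and>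
     (\<forall>f\<in>H. \<forall>g\<in>H. \<forall>h\<in>H. ip (\<lambda>x. f x + g x) h = ip f h + ip g h) \<and>
     (\<forall>a. \<forall>f\<in>H. \<forall>g\<in>H. ip (\<lambda>x. a *\<^sub>R f x) g = a * ip f g) \<and>
     (\<forall>f\<in>H. 0 \<le> ip f f) \<and>
     (\<forall>f\<in>H. ip f f = 0 \<longrightarrow> f = (\<lambda>x. 0))"

definition hilbert_function_space ::
    "('a \<Rightarrow> 'b::real_vector) set \<Rightarrow> (('a \<Rightarrow> 'b) \<Rightarrow> ('a \<Rightarrow> 'b) \<Rightarrow> real) \<Rightarrow> bool" where
  "hilbert_function_space H ip \<longleftrightarrow>
     inner_product_function_space H ip \<and> Metric_space.mcomplete H (ip_dist H ip)"

definition norm_topology ::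
    "('a \<Rightarrow> 'b::real_vector) set \<Rightarrow> (('a \<Rightarrow> 'b) \<Rightarrow> ('a \<Rightarrow> 'b) \<Rightarrow> real) \<Rightarrow> ('a \<Rightarrow> 'b) topology" where
  "norm_topology H ip = Metric_space.mtopology H (ip_dist H ip)"

definition is_rkhs ::
    "('x::real_inner \<Rightarrow> 'x \<Rightarrow> 'x \<Rightarrow>\<^sub>L 'x) \<Rightarrow> ('x \<Rightarrow> 'x) set \<Rightarrow>
     (('x \<Rightarrow> 'x) \<Rightarrow> ('x \<Rightarrow> 'x) \<Rightarrow> real) \<Rightarrow> bool" where
  "is_rkhs K H ip \<longleftrightarrow>
     hilbert_function_space H ip \<and>
     (\<forall>x c. (\<lambda>y. K y x c) \<in> H) \<and>
     (\<forall>f\<in>H. \<forall>x c. ip f (\<lambda>y. K y x c) = inner (f x) c)"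

(* mcomplete and mtopology are only meaningful on metric spaces. *)
lemma Metric_space_ip_dist:
  assumes "inner_product_function_space H ip"
  shows "Metric_space H (ip_dist H ip)"
proof -
  note A = assms[unfolded inner_product_function_space_def]
  have add: "(\<lambda>x. f x + g x) \<in> H" if "f \<in> H" "g \<in> H" for f g
    using A that by blast
  have scale: "(\<lambda>x. a *\<^sub>R f x) \<in> H" if "f \<in> H" for a f
    using A that by blast
  have sym: "ip f g = ip g f" if "f \<in> H" "g \<in> H" for f g
    using A that by blast
  have addl: "ip (\<lambda>x. f x + g x) h = ip f h + ip g h" if "f \<in> H" "g \<in> H" "h \<in> H" for f g h
    using A that by blast
  have scalel: "ip (\<lambda>x. a *\<^sub>R f x) g = a * ip f g" if "f \<in> H" "g \<in> H" for a f g
    using A that by blast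
  have nonneg: "0 \<le> ip f f" if "f \<in> H" for f
    using A that by blast
  have def0: "f = (\<lambda>x. 0)" if "f \<in> H" "ip f f = 0" for f
    using A that by blast
  have zero: "(\<lambda>x. 0) \<in> H"
    using A by blast
  have zerol: "ip (\<lambda>x. 0) g = 0" if "g \<in> H" for g
    using scalel[OF zero that, of 0] by simp
  have diff: "(\<lambda>x. f x - g x) \<in> H" if "f \<in> H" "g \<in> H" for f g
    using add[OF that(1) scale[OF that(2), of "-1"]] by simp
  have sq: "ip (\<lambda>x. f x + a *\<^sub>R g x) (\<lambda>x. f x + a *\<^sub>R g x) = ip f f + 2 * a * ip f g + a\<^sup>2 * ip g g"
    if fg: "f \<in> H" "g \<in> H" for f g a
  proof -
    have ag: "(\<lambda>x. a *\<^sub>R g x) \<in> H" using fg scale by blast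
    have s: "(\<lambda>x. f x + a *\<^sub>R g x) \<in> H" using add[OF fg(1) ag] .
    have *: "ip (\<lambda>x. f x + a *\<^sub>R g x) u = ip f u + a * ip g u" if "u \<in> H" for u
      using addl[OF fg(1) ag that] scalel[OF fg(2) that] by simp
    show ?thesis
      using *[OF s] *[OF fg(1)] *[OF fg(2)] sym[OF fg(1) s] sym[OF fg(2) s] sym[OF fg]
      by (simp add: algebra_simps power2_eq_square)
  qed
  have cs: "(ip f g)\<^sup>2 \<le> ip f f * ip g g" if fg: "f \<in> H" "g \<in> H" for f g
  proof (cases "ip g g = 0")
    case True
    then have "g = (\<lambda>x. 0)" using def0 fg by blast
    then show ?thesis using sym[OF fg] zerol[OF fg(1)] True by simp
  next
    case False
    define a where "a = - ip f g / ip g g"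
    have pos: "ip g g > 0" using nonneg[OF fg(2)] False by simp
    have "0 \<le> ip f f + 2 * a * ip f g + a\<^sup>2 * ip g g"
      using sq[OF fg, of a] nonneg[OF add[OF fg(1) scale[OF fg(2), of a]]] by simp
    also have "\<dots> = ip f f - (ip f g)\<^sup>2 / ip g g"
      using pos by (simp add: a_def field_simps power2_eq_square)
    finally show ?thesis using pos by (simp add: field_simps)
  qed
  have tri: "sqrt (ip (\<lambda>x. f x + g x) (\<lambda>x. f x + g x)) \<le> sqrt (ip f f) + sqrt (ip g g)"
    if fg: "f \<in> H" "g \<in> H" for f g
  proof -
    have "\<bar>ip f g\<bar> \<le> sqrt (ip f f) * sqrt (ip g g)"
      using real_sqrt_le_mono[OF cs[OF fg]] by (simp add: real_sqrt_mult)
    then have "ip f f + 2 * ip f g + ip g g \<le> (sqrt (ip f f) + sqrt (ip g g))\<^sup>2"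
      using nonneg[OF fg(1)] nonneg[OF fg(2)] by (simp add: power2_sum)
    then show ?thesis
      using sq[OF fg, of 1] nonneg[OF fg(1)] nonneg[OF fg(2)] by (intro real_le_lsqrt) auto
  qed
  show ?thesis
  proof
    fix f g
    show "0 \<le> ip_dist H ip f g"
      using nonneg[OF diff] by (simp add: ip_dist_def)
    show "ip_dist H ip f g = ip_dist H ip g f"
    proof (cases "f \<in> H \<and> g \<in> H")
      case True
      then have d: "(\<lambda>x. f x - g x) \<in> H" using diff by blast
      have "ip (\<lambda>x. g x - f x) (\<lambda>x. g x - f x) = ip (\<lambda>x. f x - g x) (\<lambda>x. f x - g x)"
        using sq[OF zero d, of "-1"] zerol[OF zero] zerol[OF d] by simp
      then show ?thesis by (simp add: ip_dist_def)
    qed (auto simp: ip_dist_def)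
  next
    fix f g assume fg: "f \<in> H" "g \<in> H"
    show "(ip_dist H ip f g = 0) = (f = g)"
    proof
      assume "ip_dist H ip f g = 0"
      then have "(\<lambda>x. f x - g x) = (\<lambda>x. 0)"
        using fg def0[OF diff[OF fg]] by (simp add: ip_dist_def)
      then show "f = g" by (auto simp: fun_eq_iff)
    qed (use zerol[OF zero] in \<open>simp add: ip_dist_def\<close>)
  next
    fix f g h assume "f \<in> H" "g \<in> H" "h \<in> H"
    then show "ip_dist H ip f h \<le> ip_dist H ip f g + ip_dist H ip g h"
      using tri[OF diff diff, of f g g h] by (simp add: ip_dist_def)
  qed
qed

section \<open>Machines\<close>

(* In this section the topological vector space M is a type; its scalar
   multiplication plays no role, so the class of topological abelian groups suffices. *)

definition is_stable_state ::
    "'z topology \<Rightarrow> ('m::topological_ab_group_add \<Rightarrow> 'm) \<Rightarrow> ('z \<Rightarrow> 'm) \<Rightarrow> ('z \<Rightarrow> 'm) \<Rightarrow> bool" where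
  "is_stable_state Z f g h \<longleftrightarrow>
     continuous_map Z euclidean h \<and> (\<forall>z\<in>topspace Z. h z = g z + f (h z))"

(* HOL cannot quantify over types inside a formula: the input spaces Z range over all
   topological spaces with points in 'z, and a theorem with 'z free covers every Z.
   Maps out of Z are represented uniquely by functions that are undefined off topspace Z. *)
definition machine :: "'z itself \<Rightarrow> ('m::topological_ab_group_add \<Rightarrow> 'm) \<Rightarrow> bool" where
  "machine (_ :: 'z itself) f \<longleftrightarrow>
     continuous_on UNIV f \<and>
     (\<forall>(Z :: 'z topology) g. continuous_map Z euclidean g \<longrightarrow>
        (\<exists>!h. h \<in> extensional (topspace Z) \<and> is_stable_state Z f g h))"

definition jointly_continuous ::
    "'p topology \<Rightarrow> ('p \<Rightarrow> 'm::topological_space \<Rightarrow> 'm) \<Rightarrow> bool" where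
  "jointly_continuous P f \<longleftrightarrow>
     continuous_map (prod_topology P euclidean) euclidean (\<lambda>(p, m). f p m)"

definition parametric_machine ::
    "'z itself \<Rightarrow> 'p topology \<Rightarrow> ('p \<Rightarrow> 'm::topological_ab_group_add \<Rightarrow> 'm) \<Rightarrow> bool" where
  "parametric_machine (Z :: 'z itself) P f \<longleftrightarrow>
     jointly_continuous P f \<and>
     (\<forall>p\<in>topspace P. machine Z (f p)) \<and>
     (\<forall>g h. jointly_continuous P g \<and>
        (\<forall>p\<in>topspace P. is_stable_state euclidean (f p) (g p) (h p)) \<longrightarrow>
        jointly_continuous P h)"

end

theory Submission
  imports Defs
begin

text \<open>
  By the reproducing property and (ii), every \<open>f \<in> H\<close> is causal, $\<pi>_t f = \<pi>_t f \<pi>_t$, and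
  by (i) it is Lipschitz with constant at most $\<lambda>$ times its norm. The key point is that the Lipschitz
  constant of $(\<pi>_t - \<pi>_s) f$ tends to $0$ with $t - s$, uniformly in $s$ and $t$. For $f = K(\cdot, z) c$
  this map is $K(\cdot, z) (\<pi>_t - \<pi>_s) c$, so it follows from the uniform continuity of $t \mapsto \<pi>_t c$.
  The functions with this property form a closed subspace of $H$, and the kernel functions are total.
  On a fine enough partition of $[t_0, T]$ all increments of $f$ are thus contractions with constant $1/2$,
  and $x = v + f(x)$ is solved step by step along the partition by Banach's fixed point theorem,
  with a stability estimate that depends only on the number of steps. The same partition works for
  all functions near $f$, which gives joint continuity.
\<close>

section \<open>Inner product spaces of functions\<close>

text \<open>Discriminant bound. It is used for Cauchy-Schwarz and, with \<open>c = 0\<close>, to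
  turn minimality of a distance into orthogonality.\<close>

lemma square_le_of_quadratic_nonneg:
  fixes b c e :: real
  assumes q: "\<And>a. 0 \<le> c - 2 * a * b + a\<^sup>2 * e" and "0 \<le> e"
  shows "b\<^sup>2 \<le> c * e"
proof (cases "e = 0")
  case True
  have "b = 0"
  proof (rule ccontr)
    assume "b \<noteq> 0"
    \<comment> \<open>For \<open>e = 0\<close> the expression is affine in \<open>a\<close>; at this
      point it equals -1.\<close>
    then show False using q[of "(c + 1) / (2 * b)"] True by simp
  qed
  then show ?thesis using True by simp
next
  case False
  with \<open>0 \<le> e\<close> have "e > 0" by simp
  \<comment> \<open>\<open>b / e\<close> is the minimizer of the quadratic, where its value is
    \<open>c - b^2 / e\<close>.\<close>
  then show ?thesis using q[of "b / e"] by (simp add: field_simps power2_eq_square)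
qed

locale ip_functions =
  fixes H :: "('a \<Rightarrow> 'b::real_vector) set" and ip :: "('a \<Rightarrow> 'b) \<Rightarrow> ('a \<Rightarrow> 'b) \<Rightarrow> real"
  assumes ips: "inner_product_function_space H ip"
begin

definition nrm :: "('a \<Rightarrow> 'b) \<Rightarrow> real" where
  "nrm f = sqrt (ip f f)"

lemma zero_mem: "(\<lambda>x. 0) \<in> H"
  and add_mem: "f \<in> H \<Longrightarrow> g \<in> H \<Longrightarrow> (\<lambda>x. f x + g x) \<in> H"
  and scale_mem: "f \<in> H \<Longrightarrow> (\<lambda>x. a *\<^sub>R f x) \<in> H"
  and ip_sym: "f \<in> H \<Longrightarrow> g \<in> H \<Longrightarrow> ip f g = ip g f"
  and ip_add_left: "f \<in> H \<Longrightarrow> g \<in> H \<Longrightarrow> h \<in> H \<Longrightarrow> ip (\<lambda>x. f x + g x) h = ip f h + ip g h"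
  and ip_scale_left: "f \<in> H \<Longrightarrow> g \<in> H \<Longrightarrow> ip (\<lambda>x. a *\<^sub>R f x) g = a * ip f g"
  and ip_nonneg: "f \<in> H \<Longrightarrow> 0 \<le> ip f f"
  using ips unfolding inner_product_function_space_def by blast+

lemma diff_mem:
  assumes "f \<in> H" "g \<in> H" shows "(\<lambda>x. f x - g x) \<in> H"
  using add_mem[OF assms(1) scale_mem[OF assms(2), of "-1"]] by simp

lemma ip_diff_left:
  assumes "f \<in> H" "g \<in> H" "h \<in> H"
  shows "ip (\<lambda>x. f x - g x) h = ip f h - ip g h"
  using ip_add_left[OF assms(1) scale_mem[OF assms(2), of "-1"] assms(3)]
    ip_scale_left[OF assms(2,3), of "-1"] by simp

lemma ip_diff_right:
  assumes "f \<in> H" "g \<in> H" "h \<in> H"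
  shows "ip h (\<lambda>x. f x - g x) = ip h f - ip h g"
  using ip_diff_left[OF assms] ip_sym assms diff_mem by metis

lemma ip_scale_right:
  assumes "f \<in> H" "g \<in> H"
  shows "ip g (\<lambda>x. a *\<^sub>R f x) = a * ip g f"
  using ip_scale_left[OF assms] ip_sym assms scale_mem by metis

lemma ip_diff_diff:
  assumes "f \<in> H" "g \<in> H"
  shows "ip (\<lambda>x. f x - g x) (\<lambda>x. f x - g x) = ip f f - 2 * ip f g + ip g g"
  using assms diff_mem[OF assms] ip_sym[OF assms]
  by (simp add: ip_diff_left ip_diff_right)

lemma nrm_nonneg: "f \<in> H \<Longrightarrow> 0 \<le> nrm f"
  by (simp add: nrm_def ip_nonneg)

lemma nrm_square: "f \<in> H \<Longrightarrow> (nrm f)\<^sup>2 = ip f f"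
  by (simp add: nrm_def ip_nonneg)

lemma Cauchy_Schwarz:
  assumes "f \<in> H" "g \<in> H" shows "\<bar>ip f g\<bar> \<le> nrm f * nrm g"
proof -
  have "0 \<le> ip f f - 2 * a * ip f g + a\<^sup>2 * ip g g" for a
  proof -
    have ag: "(\<lambda>x. a *\<^sub>R g x) \<in> H" using assms scale_mem by blast
    show ?thesis
      using ip_nonneg[OF diff_mem[OF assms(1) ag]] ip_diff_diff[OF assms(1) ag]
      by (simp add: ip_scale_left ip_scale_right assms ag power2_eq_square mult.assoc)
  qed
  then have "(ip f g)\<^sup>2 \<le> ip f f * ip g g"
    using square_le_of_quadratic_nonneg ip_nonneg assms by blast
  from real_sqrt_le_mono[OF this] show ?thesis
    by (simp add: nrm_def real_sqrt_mult)
qed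

sublocale M: Metric_space H "ip_dist H ip"
  using ips by (rule Metric_space_ip_dist)

lemma ip_dist_eq_nrm: "f \<in> H \<Longrightarrow> g \<in> H \<Longrightarrow> ip_dist H ip f g = nrm (\<lambda>x. f x - g x)"
  by (simp add: ip_dist_def nrm_def)

text \<open>The projection theorem: by the parallelogram law a sequence minimizing the distance to
  a closed subspace is Cauchy.\<close>

lemma closed_total_subspace_eq:
  assumes complete: "M.mcomplete"
    and closed: "closedin M.mtopology S"
    and zero: "(\<lambda>x. 0) \<in> S"
    and add: "\<And>f g. f \<in> S \<Longrightarrow> g \<in> S \<Longrightarrow> (\<lambda>x. f x + g x) \<in> S"
    and scale: "\<And>a f. f \<in> S \<Longrightarrow> (\<lambda>x. a *\<^sub>R f x) \<in> S"
    and total: "\<And>f. f \<in> H \<Longrightarrow> (\<And>g. g \<in> S \<Longrightarrow> ip f g = 0) \<Longrightarrow> f = (\<lambda>x. 0)"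
  shows "S = H"
proof
  show SH: "S \<subseteq> H" using closed closedin_subset by fastforce
  show "H \<subseteq> S"
  proof
    fix f assume f: "f \<in> H"
    define D where "D s = ip (\<lambda>x. f x - s x) (\<lambda>x. f x - s x)" for s
    define d where "d = Inf (D ` S)"
    have D_nonneg: "0 \<le> D s" if "s \<in> S" for s
      using that SH f diff_mem ip_nonneg unfolding D_def by blast
    have D_eq: "D s = ip f f - 2 * ip f s + ip s s" if "s \<in> H" for s
      unfolding D_def by (rule ip_diff_diff[OF f that])
    from D_nonneg have bdd: "bdd_below (D ` S)" by (intro bdd_belowI2)
    have d_le: "d \<le> D s" if "s \<in> S" for s
      unfolding d_def using bdd that by (simp add: cInf_lower)
    have "\<exists>s\<in>S. D s < d + 1 / Suc n" for n :: nat
    proof -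
      have "Inf (D ` S) < d + 1 / Suc n" by (simp add: d_def)
      then show ?thesis using cInf_lessD[of "D ` S"] zero by blast
    qed
    then obtain \<sigma> where \<sigma>: "\<And>n. \<sigma> n \<in> S" and D\<sigma>: "\<And>n. D (\<sigma> n) < d + 1 / Suc n"
      by metis
    have \<sigma>H: "\<sigma> n \<in> H" for n using \<sigma> SH by blast
    \<comment> \<open>Parallelogram law for \<open>f - s\<close> and \<open>f - s'\<close>: the
      squared distance of \<open>s\<close> and \<open>s'\<close> is
      \<open>2 * D s + 2 * D s' - 4 * D m\<close> with the midpoint \<open>m\<close>, and
      \<open>D m\<close> is at least \<open>d\<close> because \<open>m\<close> lies in
      \<open>S\<close>.\<close>
    have par: "(ip_dist H ip s s')\<^sup>2 \<le> 2 * (D s - d) + 2 * (D s' - d)" if s: "s \<in> S" "s' \<in> S" for s s'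
    proof -
      have sH: "s \<in> H" "s' \<in> H" using s SH by auto
      define m where "m = (\<lambda>x. (1/2) *\<^sub>R (s x + s' x))"
      have m: "m \<in> S" unfolding m_def using add scale s by blast
      have ss: "(\<lambda>x. s x + s' x) \<in> H" using add_mem sH by blast
      have ipm: "ip f m = (ip f s + ip f s') / 2"
        using ip_scale_right[OF ss f, of "1/2"] ip_add_left[OF sH f] ip_sym[OF f ss]
          ip_sym[OF f sH(1)] ip_sym[OF f sH(2)] by (simp add: m_def)
      have ipmm: "ip m m = (ip s s + 2 * ip s s' + ip s' s') / 4"
        using ip_scale_left[OF ss, of m "1/2"] ip_scale_right[OF ss ss, of "1/2"]
          ip_add_left[OF sH ss] ip_sym[OF sH(1) ss] ip_sym[OF sH(2) ss]
          ip_add_left[OF sH sH(1)] ip_add_left[OF sH sH(2)] ip_sym[OF sH] m SH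
        by (auto simp: m_def)
      have "d \<le> D m" using d_le m by blast
      moreover have "(ip_dist H ip s s')\<^sup>2 = ip s s - 2 * ip s s' + ip s' s'"
        using sH ip_diff_diff[OF sH] by (simp add: ip_dist_eq_nrm nrm_square diff_mem)
      moreover have "D m = ip f f - 2 * ip f m + ip m m"
        using D_eq m SH by blast
      moreover have "D s = ip f f - 2 * ip f s + ip s s" "D s' = ip f f - 2 * ip f s' + ip s' s'"
        using D_eq sH by blast+
      ultimately show ?thesis using ipm ipmm by argo
    qed
    have "M.MCauchy \<sigma>"
      unfolding M.MCauchy_def
    proof (intro conjI allI impI)
      show "range \<sigma> \<subseteq> H" using \<sigma>H by blast
      fix \<epsilon> :: real assume "\<epsilon> > 0"
      \<comment> \<open>By \<open>par\<close>, excesses over \<open>d\<close> below a quarter of the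
        squared \<epsilon> give a distance below \<epsilon>.\<close>
      then obtain N where N: "inverse (real (Suc N)) < \<epsilon>\<^sup>2 / 4"
        using reals_Archimedean[of "\<epsilon>\<^sup>2 / 4"] by auto
      have small: "D (\<sigma> n) - d < \<epsilon>\<^sup>2 / 4" if "n \<ge> N" for n
      proof -
        have "1 / real (Suc n) \<le> inverse (real (Suc N))"
          using that by (simp add: field_simps)
        then show ?thesis using D\<sigma>[of n] N by linarith
      qed
      show "\<exists>N. \<forall>n n'. N \<le> n \<longrightarrow> N \<le> n' \<longrightarrow> ip_dist H ip (\<sigma> n) (\<sigma> n') < \<epsilon>"
      proof (intro exI allI impI)
        fix n n' assume "N \<le> n" "N \<le> n'"
        then show "ip_dist H ip (\<sigma> n) (\<sigma> n') < \<epsilon>"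
          using par[OF \<sigma> \<sigma>, of n n'] small[of n] small[of n'] \<open>\<epsilon> > 0\<close>
          by (intro power2_less_imp_less[of _ \<epsilon>]) auto
      qed
    qed
    then obtain s where lim: "limitin M.mtopology \<sigma> s sequentially"
      using complete M.mcomplete_def by blast
    have s: "s \<in> S"
      using closed lim \<sigma> unfolding M.metric_closedin_iff_sequentially_closed by blast
    then have sH: "s \<in> H" using SH by blast
    have fs: "(\<lambda>x. f x - s x) \<in> H" using diff_mem f sH by blast
    \<comment> \<open>The limit attains the infimum: its distance from \<open>f\<close> exceeds that
      of \<open>\<sigma> n\<close> by at most the null sequence
      \<open>ip_dist H ip (\<sigma> n) s\<close>.\<close>
    have "D s \<le> d"
    proof -
      have l1: "(\<lambda>n. ip_dist H ip (\<sigma> n) s) \<longlonglongrightarrow> 0"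
        using lim unfolding M.limit_metric_sequentially LIMSEQ_iff by fastforce
      have l2: "(\<lambda>n. d + 1 / real (Suc n)) \<longlonglongrightarrow> d + 0"
        by (intro tendsto_intros LIMSEQ_Suc[OF lim_1_over_n])
      have "(\<lambda>n. sqrt (d + 1 / real (Suc n)) + ip_dist H ip (\<sigma> n) s) \<longlonglongrightarrow> sqrt (d + 0) + 0"
        by (rule tendsto_add[OF tendsto_real_sqrt[OF l2] l1])
      moreover have "sqrt (D s) \<le> sqrt (d + 1 / real (Suc n)) + ip_dist H ip (\<sigma> n) s" for n
      proof -
        have "ip_dist H ip f s \<le> ip_dist H ip f (\<sigma> n) + ip_dist H ip (\<sigma> n) s"
          using M.triangle f \<sigma>H sH by blast
        moreover have "ip_dist H ip f s = sqrt (D s)" "ip_dist H ip f (\<sigma> n) = sqrt (D (\<sigma> n))"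
          using f sH \<sigma>H by (auto simp: ip_dist_def D_def)
        moreover have "sqrt (D (\<sigma> n)) \<le> sqrt (d + 1 / real (Suc n))"
          using D\<sigma>[of n] by simp
        ultimately show ?thesis by linarith
      qed
      ultimately have "sqrt (D s) \<le> sqrt (d + 0) + 0"
        using LIMSEQ_le_const by blast
      then show ?thesis by simp
    qed
    \<comment> \<open>First variation: moving from \<open>s\<close> along \<open>g\<close> stays in
      \<open>S\<close>, so it cannot decrease \<open>D\<close>. The resulting quadratic in the step
      \<open>a\<close> has constant term 0, which forces the linear coefficient to vanish.\<close>
    have "ip (\<lambda>x. f x - s x) g = 0" if g: "g \<in> S" for g
    proof -
      have gH: "g \<in> H" using g SH by blast
      have "0 \<le> 0 - 2 * a * ip (\<lambda>x. f x - s x) g + a\<^sup>2 * ip g g" for a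
      proof -
        have ag: "(\<lambda>x. a *\<^sub>R g x) \<in> S" "(\<lambda>x. a *\<^sub>R g x) \<in> H" using g scale SH by auto
        have eq: "(\<lambda>x. f x - (s x + a *\<^sub>R g x)) = (\<lambda>x. (f x - s x) - a *\<^sub>R g x)"
          by (simp add: fun_eq_iff algebra_simps)
        have "D s \<le> D (\<lambda>x. s x + a *\<^sub>R g x)"
          using \<open>D s \<le> d\<close> d_le[OF add[OF s ag(1)]] by linarith
        also have "\<dots> = D s - 2 * a * ip (\<lambda>x. f x - s x) g + a\<^sup>2 * ip g g"
          unfolding D_def eq using ip_diff_diff[OF fs ag(2)]
          by (simp add: ip_scale_left ip_scale_right gH fs ag power2_eq_square mult.assoc)
        finally show ?thesis by simp
      qed
      then have "(ip (\<lambda>x. f x - s x) g)\<^sup>2 \<le> 0 * ip g g"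
        using square_le_of_quadratic_nonneg ip_nonneg[OF gH] by blast
      then show ?thesis by simp
    qed
    then have "(\<lambda>x. f x - s x) = (\<lambda>x. 0)" using total[OF fs] by blast
    then have "f = s" by (simp add: fun_eq_iff)
    then show "f \<in> S" using s by simp
  qed
qed

end

section \<open>Orthogonal projections\<close>

lemma is_orthogonal_projection_fixes:
  assumes "is_orthogonal_projection S p" "subspace S" "y \<in> S"
  shows "p y = y"
proof -
  have "y - p y \<in> S"
    using assms by (simp add: is_orthogonal_projection_def subspace_diff)
  then have "orthogonal (y - p y) (y - p y)"
    using assms(1) by (simp add: is_orthogonal_projection_def)
  then show ?thesis by (simp add: orthogonal_def)
qed

text \<open>Both sides equal \<open>inner (p x) (p y)\<close>, since the residuals
  \<open>x - p x\<close> and \<open>y - p y\<close> are orthogonal to \<open>S\<close>.\<close>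

lemma is_orthogonal_projection_self_adjoint:
  assumes "is_orthogonal_projection S p"
  shows "inner (p x) y = inner x (p y)"
proof -
  have "inner (x - p x) (p y) = 0" "inner (y - p y) (p x) = 0"
    using assms by (auto simp: is_orthogonal_projection_def orthogonal_def)
  then show ?thesis
    using inner_commute[of y "p x"] inner_commute[of "p y" "p x"] by (simp add: inner_diff_left)
qed

lemma is_orthogonal_projection_norm_le:
  assumes "is_orthogonal_projection S p"
  shows "norm (p x) \<le> norm x"
proof -
  have "inner (x - p x) (p x) = 0"
    using assms by (auto simp: is_orthogonal_projection_def orthogonal_def)
  then have "norm (p x) * norm (p x) = inner x (p x)"
    by (simp add: inner_diff_left flip: power2_eq_square power2_norm_eq_inner)
  also have "\<dots> \<le> norm x * norm (p x)" by (rule norm_cauchy_schwarz)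
  finally show ?thesis by (cases "p x = 0") auto
qed

text \<open>The larger projection \<open>q\<close> fixes the range of \<open>p\<close>; passing to
  adjoints turns \<open>q p = p\<close> into \<open>p q = p\<close>.\<close>

lemma is_orthogonal_projection_comp:
  assumes p: "is_orthogonal_projection S p" and q: "is_orthogonal_projection R q"
    and "subspace R" "S \<subseteq> R"
  shows "p (q x) = p x"
proof -
  have "inner (p (q x)) y = inner (p x) y" for y
  proof -
    have "q (p y) = p y"
      using is_orthogonal_projection_fixes[OF q \<open>subspace R\<close>] p \<open>S \<subseteq> R\<close>
      by (auto simp: is_orthogonal_projection_def)
    then show ?thesis
      by (simp add: is_orthogonal_projection_self_adjoint[OF p] is_orthogonal_projection_self_adjoint[OF q])
  qed
  then show ?thesis by (metis vector_eq_rdot)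
qed

section \<open>Causal maps along a finite chain of projections\<close>

text \<open>\<open>Q i\<close> stands for the projection at the i-th point of a partition of the
  time interval. Only norm bounds and composition rules of projections are kept, so the solution
  theory below works in a Banach space without an inner product.\<close>

locale causal_chain =
  fixes Q :: "nat \<Rightarrow> 'x::{real_normed_vector, complete_space} \<Rightarrow>\<^sub>L 'x" and n :: nat
    and f :: "'x \<Rightarrow> 'x"
  assumes Q_0: "Q 0 x = 0" and Q_n: "Q n x = x"
    and Q_norm_le: "i \<le> n \<Longrightarrow> norm (Q i x) \<le> norm x"
    and Q_idem: "i \<le> n \<Longrightarrow> Q i (Q i x) = Q i x"
    and Q_Suc: "i < n \<Longrightarrow> Q i (Q (Suc i) x) = Q i x"
    and causal: "i \<le> n \<Longrightarrow> Q i (f x) = Q i (f (Q i x))"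
    and contraction: "i < n \<Longrightarrow>
      norm (Q (Suc i) (f x - f y) - Q i (f x - f y)) \<le> norm (x - y) / 2"
begin

text \<open>By causality neither \<open>Q i\<close> nor \<open>Q (Suc i)\<close> after
  \<open>f\<close> sees more of the argument than its image under \<open>Q (Suc i)\<close>. Hence
  the arguments in \<open>contraction\<close> may be projected first.\<close>

lemma causal_contraction:
  assumes "i < n"
  shows "norm (Q (Suc i) (f x - f y) - Q i (f x - f y)) \<le> norm (Q (Suc i) (x - y)) / 2"
proof -
  have "Q i (f (Q (Suc i) z)) = Q i (f z)" for z
    using causal[of i "Q (Suc i) z"] causal[of i z] assms by (simp add: Q_Suc)
  moreover have "Q (Suc i) (f (Q (Suc i) z)) = Q (Suc i) (f z)" for z
    using causal[of "Suc i" z] assms by simp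
  ultimately show ?thesis
    using contraction[OF assms, of "Q (Suc i) x" "Q (Suc i) y"] by (simp add: blinfun.diff_right)
qed

text \<open>A discrete Gronwall estimate: the error is propagated along the chain, at most doubling
  in each step up to a multiple of \<open>norm e\<close>. The constant depends on \<open>n\<close>
  alone, and \<open>e = 0\<close> yields uniqueness of solutions.\<close>

lemma stability:
  assumes "x - y = e + (f x - f y)"
  shows "norm (x - y) \<le> 4 * 2 ^ n * norm e"
proof -
  \<comment> \<open>The step gives \<open>norm ?a \<le> norm ?b + 2 * norm e + norm ?a / 2\<close>.
    Absorbing the last term leads to the recursion \<open>B (Suc i) = 2 * B i + 4\<close> with
    \<open>B 0 = 0\<close>, solved by \<open>4 * 2 ^ i - 4\<close>.\<close>
  have "norm (Q i (x - y)) \<le> (4 * 2 ^ i - 4) * norm e" if "i \<le> n" for i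
    using that
  proof (induction i)
    case 0
    show ?case by (simp add: Q_0)
  next
    case (Suc i)
    then have "i < n" by simp
    let ?a = "Q (Suc i) (x - y)" and ?b = "Q i (x - y)"
    let ?r = "Q (Suc i) (f x - f y) - Q i (f x - f y)"
    have "?a = ?b + (Q (Suc i) e - Q i e) + ?r"
      unfolding assms by (simp add: blinfun.add_right)
    then have "norm ?a \<le> norm ?b + norm (Q (Suc i) e - Q i e) + norm ?r"
      by (metis norm_triangle_le norm_triangle_ineq add_right_mono)
    moreover have "norm (Q (Suc i) e - Q i e) \<le> 2 * norm e"
      using norm_triangle_ineq4[of "Q (Suc i) e" "Q i e"] Q_norm_le[of "Suc i" e]
        Q_norm_le[of i e] \<open>i < n\<close> by simp
    moreover have "norm ?r \<le> norm ?a / 2"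
      using causal_contraction[OF \<open>i < n\<close>] .
    moreover have "norm ?b \<le> (4 * 2 ^ i - 4) * norm e"
      using Suc by simp
    ultimately show ?case by (simp add: algebra_simps)
  qed
  from this[of n] have "norm (x - y) \<le> 4 * 2 ^ n * norm e - 4 * norm e"
    by (simp add: Q_n algebra_simps)
  then show ?thesis using norm_ge_zero[of e] by linarith
qed

text \<open>The equation is solved up to the i-th projection, successively in \<open>i\<close>: for
  \<open>i = 0\<close> everything vanishes, for \<open>i = n\<close> the projection is the identity.
  Each extension needs one Banach fixed point.\<close>

lemma stable_point_exists: "\<exists>u. u = v + f u"
proof -
  have "\<exists>u. u = Q i (v + f u)" if "i \<le> n" for i
    using that
  proof (induction i)
    case 0
    show ?case by (simp add: Q_0)
  next
    case (Suc i)
    then have "i < n" by simp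
    from Suc obtain u where u: "u = Q i (v + f u)" by auto
    \<comment> \<open>The part already found is frozen at \<open>u\<close>; only the new increment
      depends on \<open>w\<close>, which makes \<open>\<Phi>\<close> a contraction with constant
      1/2.\<close>
    define \<Phi> where "\<Phi> w = u + (Q (Suc i) (v + f w) - Q i (v + f w))" for w
    have "dist (\<Phi> x) (\<Phi> y) \<le> 1 / 2 * dist x y" for x y
      using contraction[OF \<open>i < n\<close>, of x y]
      by (simp add: \<Phi>_def dist_norm blinfun.add_right blinfun.diff_right algebra_simps)
    then obtain w where w: "\<Phi> w = w"
      using banach_fix_type[of "1 / 2" \<Phi>] by auto
    \<comment> \<open>Applying \<open>Q i\<close> to the fixed point equation removes the increment,
      so \<open>w\<close> extends \<open>u\<close>. By causality \<open>u\<close> may then be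
      rewritten as \<open>Q i (v + f w)\<close>, and the terms with \<open>Q i\<close> in
      \<open>\<Phi> w\<close> cancel.\<close>
    have "Q i u = u" using u Q_idem[of i "v + f u"] \<open>i < n\<close> by (metis less_imp_le)
    then have "Q i w = u"
      using \<open>i < n\<close> arg_cong[OF w, of "Q i"]
      by (simp add: \<Phi>_def blinfun.add_right blinfun.diff_right Q_Suc Q_idem)
    then have "Q i (v + f w) = Q i (v + f u)"
      using causal[of i w] \<open>i < n\<close> by (simp add: blinfun.add_right)
    with u have "\<Phi> w = Q (Suc i) (v + f w)" by (simp add: \<Phi>_def)
    then show ?case using w by auto
  qed
  from this[of n] show ?thesis by (simp add: Q_n)
qed

text \<open>The solution map \<open>S\<close> is Lipschitz by \<open>stability\<close>, so the
  stable state for any input \<open>g\<close> is the composition of \<open>S\<close> with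
  \<open>g\<close>, whatever the space \<open>Z\<close>.\<close>

lemma machine_causal_map:
  assumes "continuous_on UNIV f"
  shows "machine TYPE('z) f"
  unfolding machine_def
proof (intro conjI allI impI assms)
  fix Z :: "'z topology" and g :: "'z \<Rightarrow> 'x"
  assume g: "continuous_map Z euclidean g"
  obtain S where S: "\<And>v. S v = v + f (S v)"
    using stable_point_exists by metis
  have S_lip: "dist (S v) (S w) \<le> 4 * 2 ^ n * dist v w" for v w
    using stability[of "S v" "S w" "v - w"] S[of v] S[of w] by (simp add: dist_norm algebra_simps)
  then have "(4 * 2 ^ n)-lipschitz_on UNIV S"
    by (intro lipschitz_onI) auto
  then have "continuous_on UNIV S"
    by (rule lipschitz_on_continuous_on)
  then have "continuous_map Z euclidean (S \<circ> g)"
    using g continuous_map_compose continuous_map_iff_continuous2 by blast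
  then have cont: "continuous_map Z euclidean (restrict (S \<circ> g) (topspace Z))"
    by (rule continuous_map_eq) simp
  show "\<exists>!h. h \<in> extensional (topspace Z) \<and> is_stable_state Z f g h"
  proof (rule ex1I[of _ "restrict (S \<circ> g) (topspace Z)"])
    show "restrict (S \<circ> g) (topspace Z) \<in> extensional (topspace Z) \<and>
        is_stable_state Z f g (restrict (S \<circ> g) (topspace Z))"
      using cont S by (auto simp: is_stable_state_def)
  next
    fix h assume h: "h \<in> extensional (topspace Z) \<and> is_stable_state Z f g h"
    have "h z = S (g z)" if "z \<in> topspace Z" for z
    proof -
      have "h z = g z + f (h z)" using h that by (auto simp: is_stable_state_def)
      then have "h z - S (g z) = 0 + (f (h z) - f (S (g z)))"
        using S[of "g z"] by (metis add_diff_cancel_left add_0)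
      from stability[OF this] show ?thesis by simp
    qed
    then show "h = restrict (S \<circ> g) (topspace Z)"
      using h by (intro extensionalityI[of _ "topspace Z"]) auto
  qed
qed

end

section \<open>Joint continuity through open boxes and distances\<close>

lemma jointly_continuous_metric:
  fixes f :: "'p \<Rightarrow> 'm::metric_space \<Rightarrow> 'm"
  shows "jointly_continuous P f \<longleftrightarrow>
    (\<forall>p\<in>topspace P. \<forall>m. \<forall>\<epsilon>>0. \<exists>U V. openin P U \<and> open V \<and> p \<in> U \<and> m \<in> V \<and>
       (\<forall>p'\<in>U. \<forall>m'\<in>V. dist (f p' m') (f p m) < \<epsilon>))" (is "?L = ?R")
proof -
  have "?L \<longleftrightarrow> (\<forall>z\<in>topspace (prod_topology P (euclidean :: 'm topology)). \<forall>\<epsilon>>0.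
      \<exists>W. openin (prod_topology P euclidean) W \<and> z \<in> W \<and>
        (\<forall>w\<in>W. dist (case z of (p, m) \<Rightarrow> f p m) (case w of (p, m) \<Rightarrow> f p m) < \<epsilon>))"
    using Met_TC.continuous_map_to_metric[of "prod_topology P euclidean" "\<lambda>(p, m). f p m"]
    by (simp add: jointly_continuous_def)
  also have "\<dots> \<longleftrightarrow> ?R"
  proof (intro iffI ballI allI impI)
    fix p and m :: 'm and \<epsilon> :: real
    assume A: "\<forall>z\<in>topspace (prod_topology P (euclidean :: 'm topology)). \<forall>\<epsilon>>0.
      \<exists>W. openin (prod_topology P euclidean) W \<and> z \<in> W \<and>
        (\<forall>w\<in>W. dist (case z of (p, m) \<Rightarrow> f p m) (case w of (p, m) \<Rightarrow> f p m) < \<epsilon>)"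
      and "p \<in> topspace P" "\<epsilon> > 0"
    then have "(p, m) \<in> topspace (prod_topology P euclidean)" by simp
    with A[rule_format, OF this \<open>\<epsilon> > 0\<close>] obtain W where W: "openin (prod_topology P euclidean) W"
      "(p, m) \<in> W" "\<And>w. w \<in> W \<Longrightarrow> dist (f p m) (case w of (p, m) \<Rightarrow> f p m) < \<epsilon>"
      by (simp only: prod.case) blast
    obtain U V where "openin P U" "open V" "p \<in> U" "m \<in> V" "U \<times> V \<subseteq> W"
      using openin_prod_topology_alt[THEN iffD1, rule_format, OF W(1,2)] by auto
    then show "\<exists>U V. openin P U \<and> open V \<and> p \<in> U \<and> m \<in> V \<and>
       (\<forall>p'\<in>U. \<forall>m'\<in>V. dist (f p' m') (f p m) < \<epsilon>)"
      using W(3) by (intro exI[of _ U] exI[of _ V]) (fastforce simp: dist_commute)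
  next
    fix z and \<epsilon> :: real
    assume R: ?R and z: "z \<in> topspace (prod_topology P (euclidean :: 'm topology))" "\<epsilon> > 0"
    obtain p m where pm: "z = (p, m)" "p \<in> topspace P" using z by (cases z) auto
    with R \<open>\<epsilon> > 0\<close> obtain U V where UV: "openin P U" "open V" "p \<in> U" "m \<in> V"
      "\<forall>p'\<in>U. \<forall>m'\<in>V. dist (f p' m') (f p m) < \<epsilon>"
      by meson
    then show "\<exists>W. openin (prod_topology P euclidean) W \<and> z \<in> W \<and>
        (\<forall>w\<in>W. dist (case z of (p, m) \<Rightarrow> f p m) (case w of (p, m) \<Rightarrow> f p m) < \<epsilon>)"
      by (intro exI[of _ "U \<times> V"]) (auto simp: openin_prod_Times_iff pm dist_commute)
  qed
  finally show ?thesis .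
qed

section \<open>Operator-valued reproducing kernels\<close>

locale rkhs =
  fixes K :: "'x::real_inner \<Rightarrow> 'x \<Rightarrow> 'x \<Rightarrow>\<^sub>L 'x" and H ip
  assumes is_rkhs: "is_rkhs K H ip"
begin

sublocale ip_functions H ip
  using is_rkhs by unfold_locales (simp add: is_rkhs_def hilbert_function_space_def)

lemma complete: "M.mcomplete"
  and kernel_mem: "(\<lambda>y. K y x c) \<in> H"
  and reproducing: "f \<in> H \<Longrightarrow> ip f (\<lambda>y. K y x c) = inner (f x) c"
  using is_rkhs by (auto simp: is_rkhs_def hilbert_function_space_def)

lemma ip_kernel_kernel: "ip (\<lambda>y. K y x c) (\<lambda>y. K y z d) = inner (K z x c) d"
  using reproducing kernel_mem by blast

text \<open>The squared norm of the kernel function is \<open>inner (K x x c) c\<close>.\<close>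

lemma nrm_kernel_le: "nrm (\<lambda>y. K y x c) \<le> sqrt (norm (K x x)) * norm c"
proof -
  have "inner (K x x c) c \<le> norm (K x x c) * norm c" by (rule norm_cauchy_schwarz)
  also have "\<dots> \<le> norm (K x x) * norm c * norm c"
    by (intro mult_right_mono norm_blinfun) auto
  finally have "nrm (\<lambda>y. K y x c) \<le> sqrt (norm (K x x) * norm c * norm c)"
    by (simp add: nrm_def ip_kernel_kernel)
  then show ?thesis by (simp add: real_sqrt_mult mult.assoc)
qed

text \<open>The reproducing property is tested with \<open>c = f x\<close>; after Cauchy-Schwarz one
  factor \<open>norm (f x)\<close> cancels.\<close>

lemma norm_eval_le:
  assumes "f \<in> H" shows "norm (f x) \<le> sqrt (norm (K x x)) * nrm f"
proof -
  have "norm (f x) * norm (f x) = ip f (\<lambda>y. K y x (f x))"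
    by (simp add: reproducing assms flip: power2_eq_square power2_norm_eq_inner)
  also have "\<dots> \<le> nrm f * nrm (\<lambda>y. K y x (f x))"
    using Cauchy_Schwarz[OF assms kernel_mem] by (rule order.trans[OF abs_ge_self])
  also have "\<dots> \<le> nrm f * (sqrt (norm (K x x)) * norm (f x))"
    by (intro mult_left_mono nrm_kernel_le nrm_nonneg assms)
  finally have "norm (f x) * norm (f x) \<le> (sqrt (norm (K x x)) * nrm f) * norm (f x)"
    by (simp add: mult_ac)
  then show ?thesis
    using nrm_nonneg[OF assms] by (cases "f x = 0") auto
qed

text \<open>This links hypothesis (i) to the geometry of \<open>H\<close>: the operator bounded
  there is the quadratic form of differences of kernel functions.\<close>

lemma ip_kernel_diff:
  "ip (\<lambda>y. K y x c - K y z c) (\<lambda>y. K y x c - K y z c)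
    = inner ((K x x + K z z - 2 *\<^sub>R K x z) c) c"
proof -
  \<comment> \<open>Symmetry of \<open>ip\<close> merges the two mixed terms into one.\<close>
  have "inner (K z x c) c = inner (K x z c) c"
    using ip_sym[OF kernel_mem kernel_mem] by (simp add: ip_kernel_kernel)
  then show ?thesis
    using ip_diff_diff[OF kernel_mem[of x c] kernel_mem[of z c]]
    by (simp add: ip_kernel_kernel blinfun.add_left blinfun.diff_left blinfun.scaleR_left
        inner_add_left inner_diff_left)
qed

text \<open>As for \<open>norm_eval_le\<close>, now with \<open>c = f x - f z\<close>: the function
  \<open>?k\<close> represents the difference of the two evaluations in direction \<open>c\<close>,
  and (i) bounds its norm.\<close>

lemma eval_lipschitz:
  assumes lip: "norm (K x x + K z z - 2 *\<^sub>R K x z) \<le> L\<^sup>2 * (norm (x - z))\<^sup>2"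
    and "0 \<le> L" "f \<in> H"
  shows "norm (f x - f z) \<le> L * nrm f * norm (x - z)"
proof -
  define c where "c = f x - f z"
  let ?k = "\<lambda>y. K y x c - K y z c"
  have k: "?k \<in> H" by (rule diff_mem[OF kernel_mem kernel_mem])
  have "inner ((K x x + K z z - 2 *\<^sub>R K x z) c) c \<le> norm ((K x x + K z z - 2 *\<^sub>R K x z) c) * norm c"
    by (rule norm_cauchy_schwarz)
  also have "\<dots> \<le> norm (K x x + K z z - 2 *\<^sub>R K x z) * norm c * norm c"
    by (intro mult_right_mono norm_blinfun) auto
  also have "\<dots> \<le> L\<^sup>2 * (norm (x - z))\<^sup>2 * norm c * norm c"
    by (intro mult_right_mono lip) auto
  also have "\<dots> = (L * norm (x - z) * norm c)\<^sup>2"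
    by (simp add: power2_eq_square)
  finally have "nrm ?k \<le> L * norm (x - z) * norm c"
    unfolding nrm_def ip_kernel_diff using \<open>0 \<le> L\<close> by (intro real_le_lsqrt) auto
  then have "nrm f * nrm ?k \<le> nrm f * (L * norm (x - z) * norm c)"
    by (intro mult_left_mono nrm_nonneg assms)
  moreover have "norm c * norm c = ip f ?k"
    using ip_diff_right[OF kernel_mem kernel_mem \<open>f \<in> H\<close>, of x c z c]
    by (simp add: reproducing \<open>f \<in> H\<close> c_def flip: power2_eq_square)
      (simp add: power2_norm_eq_inner inner_diff_left)
  moreover have "ip f ?k \<le> nrm f * nrm ?k"
    using Cauchy_Schwarz[OF \<open>f \<in> H\<close> k] by (rule order.trans[OF abs_ge_self])
  ultimately have "norm c * norm c \<le> (L * nrm f * norm (x - z)) * norm c"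
    by (simp add: mult_ac)
  then show ?thesis
    using nrm_nonneg[OF \<open>f \<in> H\<close>] \<open>0 \<le> L\<close> by (cases "c = 0") (auto simp flip: c_def)
qed

text \<open>Taking \<open>c = f x\<close> shows that a function orthogonal to all kernel functions
  vanishes at each \<open>x\<close>.\<close>

lemma kernel_total:
  assumes "f \<in> H" and "\<And>x c. ip f (\<lambda>y. K y x c) = 0"
  shows "f = (\<lambda>x. 0)"
proof
  fix x
  have "inner (f x) (f x) = 0" using assms by (simp flip: reproducing)
  then show "f x = 0" by simp
qed

end

section \<open>Causal reproducing kernels\<close>

locale causal_rkhs = rkhs K H ip
  for K :: "'x::{real_inner, complete_space} \<Rightarrow> 'x \<Rightarrow> 'x \<Rightarrow>\<^sub>L 'x" and H ip +
  fixes t0 T :: real and F :: "real \<Rightarrow> 'x set" and \<pi> :: "real \<Rightarrow> 'x \<Rightarrow>\<^sub>L 'x" and L :: real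
  assumes t0_less_T: "t0 < T"
    and continuous_filtration: "continuous_filtration t0 T F \<pi>"
    and L_pos: "0 < L"
    and kernel_lipschitz: "norm (K x x + K z z - 2 *\<^sub>R K x z) \<le> L\<^sup>2 * (norm (x - z))\<^sup>2"
    and kernel_commute: "t \<in> {t0..T} \<Longrightarrow> K x z (\<pi> t c) = \<pi> t (K x z c)"
    and kernel_causal: "t \<in> {t0..T} \<Longrightarrow> \<pi> t (K x z c) = \<pi> t (K (\<pi> t x) (\<pi> t z) c)"
begin

lemma projection: "t \<in> {t0..T} \<Longrightarrow> is_orthogonal_projection (F t) (\<pi> t)"
  and subspace_F: "t \<in> {t0..T} \<Longrightarrow> subspace (F t)"
  and F_mono: "s \<in> {t0..T} \<Longrightarrow> t \<in> {t0..T} \<Longrightarrow> s \<le> t \<Longrightarrow> F s \<subseteq> F t"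
  and F_t0: "F t0 = {0}" and F_T: "F T = UNIV"
  and continuous_on_projection: "continuous_on {t0..T} (\<lambda>t. \<pi> t x)"
  using continuous_filtration
  by (auto simp: continuous_filtration_def filtration_def filtration_projections_def)

lemma projection_norm_le: "t \<in> {t0..T} \<Longrightarrow> norm (\<pi> t x) \<le> norm x"
  using is_orthogonal_projection_norm_le projection by blast

lemma projection_comp:
  assumes "s \<in> {t0..T}" "t \<in> {t0..T}" "s \<le> t"
  shows "\<pi> s (\<pi> t x) = \<pi> s x"
  using assms projection subspace_F F_mono is_orthogonal_projection_comp by meson

lemma projection_t0: "\<pi> t0 x = 0"
  using projection[of t0] t0_less_T by (simp add: is_orthogonal_projection_def F_t0)

lemma projection_T: "\<pi> T x = x"
  using is_orthogonal_projection_fixes[OF projection[of T] subspace_F[of T]] t0_less_T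
  by (simp add: F_T)

lemma lipschitz_H: "f \<in> H \<Longrightarrow> norm (f x - f y) \<le> L * nrm f * norm (x - y)"
  using eval_lipschitz[OF kernel_lipschitz] L_pos by simp

text \<open>By (ii), the kernel functions at \<open>x\<close> and at \<open>\<pi> t x\<close>
  coincide in every direction \<open>\<pi> t c\<close>. The reproducing property passes this on to
  \<open>f\<close>, and self-adjointness moves \<open>\<pi> t\<close> back onto the values.\<close>

lemma causal_H:
  assumes t: "t \<in> {t0..T}" and "f \<in> H"
  shows "\<pi> t (f x) = \<pi> t (f (\<pi> t x))"
proof -
  have "K z x (\<pi> t c) = K z (\<pi> t x) (\<pi> t c)" for z c
    using kernel_causal[OF t, of z x c] kernel_causal[OF t, of z "\<pi> t x" c]
    by (simp add: kernel_commute[OF t] projection_comp[OF t t])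
  then have "inner (f x) (\<pi> t c) = inner (f (\<pi> t x)) (\<pi> t c)" for c
    using reproducing[OF \<open>f \<in> H\<close>, of x "\<pi> t c"] reproducing[OF \<open>f \<in> H\<close>, of "\<pi> t x" "\<pi> t c"] by simp
  then have "inner (\<pi> t (f x)) c = inner (\<pi> t (f (\<pi> t x))) c" for c
    using is_orthogonal_projection_self_adjoint[OF projection[OF t]] by simp
  then show ?thesis by (metis vector_eq_rdot)
qed

section \<open>Increments over short time intervals\<close>

definition increment :: "real \<Rightarrow> real \<Rightarrow> 'x \<Rightarrow> 'x" where
  "increment s t x = \<pi> t x - \<pi> s x"

lemma increment_add: "increment s t (x + y) = increment s t x + increment s t y"
  and increment_diff: "increment s t (x - y) = increment s t x - increment s t y"
  and increment_scale: "increment s t (a *\<^sub>R x) = a *\<^sub>R increment s t x"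
  by (simp_all add: increment_def blinfun.add_right blinfun.diff_right blinfun.scaleR_right
      algebra_simps)

lemma norm_increment_le:
  assumes "s \<in> {t0..T}" "t \<in> {t0..T}"
  shows "norm (increment s t x) \<le> 2 * norm x"
  unfolding increment_def
  using norm_triangle_ineq4[of "\<pi> t x" "\<pi> s x"] projection_norm_le[OF assms(1), of x]
    projection_norm_le[OF assms(2), of x] by linarith

text \<open>The difference \<open>f - g\<close> is Lipschitz with constant \<open>L\<close> times
  the distance of \<open>f\<close> and \<open>g\<close>, and an increment at most doubles norms.
  Estimates for \<open>g\<close> thus carry over to all nearby \<open>f\<close>.\<close>

lemma increment_perturb:
  assumes "s \<in> {t0..T}" "t \<in> {t0..T}" "f \<in> H" "g \<in> H"
  shows "norm (increment s t (f x - f y))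
    \<le> norm (increment s t (g x - g y)) + 2 * L * ip_dist H ip f g * norm (x - y)"
proof -
  let ?h = "\<lambda>x. f x - g x"
  have h: "?h \<in> H" using diff_mem assms by blast
  have "f x - f y = (g x - g y) + (?h x - ?h y)" by simp
  then have "norm (increment s t (f x - f y))
      \<le> norm (increment s t (g x - g y)) + norm (increment s t (?h x - ?h y))"
    by (metis increment_add norm_triangle_ineq)
  moreover have "norm (increment s t (?h x - ?h y)) \<le> 2 * norm (?h x - ?h y)"
    by (rule norm_increment_le[OF assms(1,2)])
  moreover have "norm (?h x - ?h y) \<le> L * ip_dist H ip f g * norm (x - y)"
    using lipschitz_H[OF h] assms by (simp add: ip_dist_eq_nrm)
  ultimately show ?thesis by linarith
qed

text \<open>The bound for all \<open>x\<close> and \<open>y\<close> controls a Lipschitz constant;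
  \<delta> is uniform in the position of the interval, as needed for partitions.\<close>

definition vanishing_increments :: "('x \<Rightarrow> 'x) set" where
  "vanishing_increments = {f \<in> H. \<forall>\<epsilon>>0. \<exists>\<delta>>0. \<forall>s\<in>{t0..T}. \<forall>t\<in>{t0..T}. \<bar>t - s\<bar> < \<delta> \<longrightarrow>
     (\<forall>x y. norm (increment s t (f x - f y)) \<le> \<epsilon> * norm (x - y))}"

lemma vanishing_incrementsE:
  assumes "f \<in> vanishing_increments" "\<epsilon> > 0"
  obtains \<delta> where "\<delta> > 0"
    "\<And>s t x y. s \<in> {t0..T} \<Longrightarrow> t \<in> {t0..T} \<Longrightarrow> \<bar>t - s\<bar> < \<delta> \<Longrightarrow>
       norm (increment s t (f x - f y)) \<le> \<epsilon> * norm (x - y)"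
proof -
  have "\<exists>\<delta>>0. \<forall>s\<in>{t0..T}. \<forall>t\<in>{t0..T}. \<bar>t - s\<bar> < \<delta> \<longrightarrow>
     (\<forall>x y. norm (increment s t (f x - f y)) \<le> \<epsilon> * norm (x - y))"
    using assms by (simp add: vanishing_increments_def)
  then obtain \<delta> where "\<delta> > 0" and \<delta>: "\<forall>s\<in>{t0..T}. \<forall>t\<in>{t0..T}. \<bar>t - s\<bar> < \<delta> \<longrightarrow>
     (\<forall>x y. norm (increment s t (f x - f y)) \<le> \<epsilon> * norm (x - y))"
    by blast
  from \<open>\<delta> > 0\<close> \<delta>[rule_format] show thesis by (rule that)
qed

lemma vanishing_incrementsI:
  assumes "f \<in> H"
    and "\<And>\<epsilon>. \<epsilon> > 0 \<Longrightarrow> \<exists>\<delta>>0. \<forall>s\<in>{t0..T}. \<forall>t\<in>{t0..T}. \<bar>t - s\<bar> < \<delta> \<longrightarrow>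
     (\<forall>x y. norm (increment s t (f x - f y)) \<le> \<epsilon> * norm (x - y))"
  shows "f \<in> vanishing_increments"
  using assms by (simp add: vanishing_increments_def)

lemma vanishing_increments_add:
  assumes f: "f \<in> vanishing_increments" and g: "g \<in> vanishing_increments"
  shows "(\<lambda>x. f x + g x) \<in> vanishing_increments"
proof (rule vanishing_incrementsI)
  show "(\<lambda>x. f x + g x) \<in> H"
    using f g add_mem by (simp add: vanishing_increments_def)
  fix \<epsilon> :: real assume "\<epsilon> > 0"
  then have "\<epsilon> / 2 > 0" by simp
  obtain \<delta>1 where 1: "\<delta>1 > 0" "\<And>s t x y. s \<in> {t0..T} \<Longrightarrow> t \<in> {t0..T} \<Longrightarrow> \<bar>t - s\<bar> < \<delta>1 \<Longrightarrow>
       norm (increment s t (f x - f y)) \<le> \<epsilon> / 2 * norm (x - y)"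
    using vanishing_incrementsE[OF f \<open>\<epsilon> / 2 > 0\<close>] by blast
  obtain \<delta>2 where 2: "\<delta>2 > 0" "\<And>s t x y. s \<in> {t0..T} \<Longrightarrow> t \<in> {t0..T} \<Longrightarrow> \<bar>t - s\<bar> < \<delta>2 \<Longrightarrow>
       norm (increment s t (g x - g y)) \<le> \<epsilon> / 2 * norm (x - y)"
    using vanishing_incrementsE[OF g \<open>\<epsilon> / 2 > 0\<close>] by blast
  show "\<exists>\<delta>>0. \<forall>s\<in>{t0..T}. \<forall>t\<in>{t0..T}. \<bar>t - s\<bar> < \<delta> \<longrightarrow>
     (\<forall>x y. norm (increment s t ((f x + g x) - (f y + g y))) \<le> \<epsilon> * norm (x - y))"
  proof (intro exI[of _ "min \<delta>1 \<delta>2"] conjI ballI impI allI)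
    fix s t x y assume st: "s \<in> {t0..T}" "t \<in> {t0..T}" "\<bar>t - s\<bar> < min \<delta>1 \<delta>2"
    have "increment s t ((f x + g x) - (f y + g y)) = increment s t (f x - f y) + increment s t (g x - g y)"
      by (simp add: increment_add increment_diff)
    then have "norm (increment s t ((f x + g x) - (f y + g y)))
        \<le> norm (increment s t (f x - f y)) + norm (increment s t (g x - g y))"
      by (simp add: norm_triangle_ineq)
    then show "norm (increment s t ((f x + g x) - (f y + g y))) \<le> \<epsilon> * norm (x - y)"
      using 1(2)[of s t x y] 2(2)[of s t x y] st by simp
  qed (use 1 2 in auto)
qed

lemma vanishing_increments_scale:
  assumes f: "f \<in> vanishing_increments"
  shows "(\<lambda>x. a *\<^sub>R f x) \<in> vanishing_increments"
proof (rule vanishing_incrementsI)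
  show "(\<lambda>x. a *\<^sub>R f x) \<in> H"
    using f scale_mem by (simp add: vanishing_increments_def)
  fix \<epsilon> :: real assume "\<epsilon> > 0"
  \<comment> \<open>The summand 1 covers \<open>a = 0\<close>.\<close>
  then have "\<epsilon> / (\<bar>a\<bar> + 1) > 0" by simp
  then obtain \<delta> where \<delta>: "\<delta> > 0" "\<And>s t x y. s \<in> {t0..T} \<Longrightarrow> t \<in> {t0..T} \<Longrightarrow> \<bar>t - s\<bar> < \<delta> \<Longrightarrow>
       norm (increment s t (f x - f y)) \<le> \<epsilon> / (\<bar>a\<bar> + 1) * norm (x - y)"
    using vanishing_incrementsE[OF f] by blast
  show "\<exists>\<delta>>0. \<forall>s\<in>{t0..T}. \<forall>t\<in>{t0..T}. \<bar>t - s\<bar> < \<delta> \<longrightarrow>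
     (\<forall>x y. norm (increment s t (a *\<^sub>R f x - a *\<^sub>R f y)) \<le> \<epsilon> * norm (x - y))"
  proof (intro exI[of _ \<delta>] conjI ballI impI allI)
    fix s t x y assume st: "s \<in> {t0..T}" "t \<in> {t0..T}" "\<bar>t - s\<bar> < \<delta>"
    have "norm (increment s t (a *\<^sub>R f x - a *\<^sub>R f y)) = \<bar>a\<bar> * norm (increment s t (f x - f y))"
      by (simp add: increment_scale flip: scaleR_diff_right)
    also have "\<dots> \<le> (\<bar>a\<bar> + 1) * (\<epsilon> / (\<bar>a\<bar> + 1) * norm (x - y))"
      using \<delta>(2)[OF st] by (intro mult_mono) auto
    also have "\<dots> = \<epsilon> * norm (x - y)"
      using abs_ge_zero[of a] by (simp add: field_simps)
    finally show "norm (increment s t (a *\<^sub>R f x - a *\<^sub>R f y)) \<le> \<epsilon> * norm (x - y)" .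
  qed (use \<delta> in auto)
qed

lemma vanishing_increments_closed: "closedin M.mtopology vanishing_increments"
  unfolding M.metric_closedin_iff_sequentially_closed
proof (intro conjI allI impI)
  show "vanishing_increments \<subseteq> H" by (auto simp: vanishing_increments_def)
  fix \<sigma> f assume *: "range \<sigma> \<subseteq> vanishing_increments \<and> limitin M.mtopology \<sigma> f sequentially"
  then have f: "f \<in> H" by (simp add: M.limit_metric_sequentially)
  then show "f \<in> vanishing_increments"
  proof (rule vanishing_incrementsI)
    fix \<epsilon> :: real assume "\<epsilon> > 0"
    \<comment> \<open>The factor \<open>2 * L\<close> of \<open>increment_perturb\<close> turns the
      distance \<open>\<epsilon> / (4 * L)\<close> into the second half of \<epsilon>.\<close>
    then have "\<epsilon> / 2 > 0" "\<epsilon> / (4 * L) > 0" using L_pos by auto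
    then obtain n where n: "ip_dist H ip (\<sigma> n) f < \<epsilon> / (4 * L)"
      using * unfolding M.limit_metric_sequentially by blast
    have \<sigma>: "\<sigma> n \<in> vanishing_increments" using * by blast
    then have \<sigma>H: "\<sigma> n \<in> H" by (simp add: vanishing_increments_def)
    obtain \<delta> where \<delta>: "\<delta> > 0" "\<And>s t x y. s \<in> {t0..T} \<Longrightarrow> t \<in> {t0..T} \<Longrightarrow> \<bar>t - s\<bar> < \<delta> \<Longrightarrow>
       norm (increment s t (\<sigma> n x - \<sigma> n y)) \<le> \<epsilon> / 2 * norm (x - y)"
      using vanishing_incrementsE[OF \<sigma> \<open>\<epsilon> / 2 > 0\<close>] by blast
    have "2 * L * ip_dist H ip f (\<sigma> n) \<le> \<epsilon> / 2"
      using n L_pos by (simp add: M.commute[of f] field_simps)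
    then have d: "2 * L * ip_dist H ip f (\<sigma> n) * norm (x - y) \<le> \<epsilon> / 2 * norm (x - y)" for x y :: 'x
      by (intro mult_right_mono) auto
    show "\<exists>\<delta>>0. \<forall>s\<in>{t0..T}. \<forall>t\<in>{t0..T}. \<bar>t - s\<bar> < \<delta> \<longrightarrow>
       (\<forall>x y. norm (increment s t (f x - f y)) \<le> \<epsilon> * norm (x - y))"
    proof (intro exI[of _ \<delta>] conjI ballI impI allI \<delta>(1))
      fix s t x y assume st: "s \<in> {t0..T}" "t \<in> {t0..T}" "\<bar>t - s\<bar> < \<delta>"
      show "norm (increment s t (f x - f y)) \<le> \<epsilon> * norm (x - y)"
        using increment_perturb[OF st(1,2) f \<sigma>H, of x y] \<delta>(2)[OF st, of x y] d[of x y] by simp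
    qed
  qed
qed

text \<open>Since the kernel commutes with the projections, the increment can be moved onto
  \<open>c\<close>. What remains is the kernel function in direction \<open>increment s t c\<close>,
  which is uniformly small because \<open>\<pi> t c\<close> is uniformly continuous in
  \<open>t\<close> on a compact interval.\<close>

lemma kernel_vanishing_increments: "(\<lambda>y. K y z c) \<in> vanishing_increments"
proof (rule vanishing_incrementsI[OF kernel_mem])
  fix \<epsilon> :: real assume "\<epsilon> > 0"
  \<comment> \<open>Adding 1 keeps \<open>B\<close> positive even if \<open>K z z\<close> is
    zero.\<close>
  define B where "B = L * (sqrt (norm (K z z)) + 1)"
  have "B > 0" using L_pos by (simp add: B_def add_nonneg_pos)
  have "uniformly_continuous_on {t0..T} (\<lambda>t. \<pi> t c)"
    using compact_uniformly_continuous[OF continuous_on_projection] by simp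
  then obtain \<delta> where \<delta>: "\<delta> > 0"
    "\<And>s t. s \<in> {t0..T} \<Longrightarrow> t \<in> {t0..T} \<Longrightarrow> dist t s < \<delta> \<Longrightarrow> dist (\<pi> t c) (\<pi> s c) < \<epsilon> / B"
    using \<open>\<epsilon> > 0\<close> \<open>B > 0\<close> unfolding uniformly_continuous_on_def by (metis divide_pos_pos)
  show "\<exists>\<delta>>0. \<forall>s\<in>{t0..T}. \<forall>t\<in>{t0..T}. \<bar>t - s\<bar> < \<delta> \<longrightarrow>
     (\<forall>x y. norm (increment s t (K x z c - K y z c)) \<le> \<epsilon> * norm (x - y))"
  proof (intro exI[of _ \<delta>] conjI ballI impI allI \<delta>(1))
    fix s t x y assume st: "s \<in> {t0..T}" "t \<in> {t0..T}" "\<bar>t - s\<bar> < \<delta>"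
    define d where "d = increment s t c"
    have "norm d \<le> \<epsilon> / B"
      using \<delta>(2)[OF st(1,2)] st(3) by (simp add: d_def increment_def dist_norm)
    have "increment s t (K y z c) = K y z d" for y
      using st by (simp add: d_def increment_def blinfun.diff_right kernel_commute)
    then have "norm (increment s t (K x z c - K y z c)) = norm (K x z d - K y z d)"
      by (simp add: increment_diff)
    also have "\<dots> \<le> L * nrm (\<lambda>y. K y z d) * norm (x - y)"
      using lipschitz_H[OF kernel_mem] .
    also have "\<dots> \<le> L * (sqrt (norm (K z z)) * norm d) * norm (x - y)"
      using L_pos by (intro mult_right_mono mult_left_mono nrm_kernel_le) auto
    also have "\<dots> \<le> B * (\<epsilon> / B) * norm (x - y)"
    proof (rule mult_right_mono)
      have "L * sqrt (norm (K z z)) * norm d \<le> B * (\<epsilon> / B)"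
        using L_pos \<open>norm d \<le> \<epsilon> / B\<close> \<open>B > 0\<close>
        by (intro mult_mono) (auto simp: B_def)
      then show "L * (sqrt (norm (K z z)) * norm d) \<le> B * (\<epsilon> / B)" by (simp add: mult.assoc)
    qed simp
    finally show "norm (increment s t (K x z c - K y z c)) \<le> \<epsilon> * norm (x - y)"
      using \<open>B > 0\<close> by simp
  qed
qed

text \<open>A closed subspace that contains a total family is the whole space.\<close>

lemma vanishing_increments_eq: "vanishing_increments = H"
proof (rule closed_total_subspace_eq[OF complete vanishing_increments_closed])
  show "(\<lambda>x. 0) \<in> vanishing_increments"
    using vanishing_increments_scale[OF kernel_vanishing_increments, of 0] by simp
  show "f = (\<lambda>x. 0)" if "f \<in> H" "\<And>g. g \<in> vanishing_increments \<Longrightarrow> ip f g = 0" for f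
    using kernel_total[OF that(1)] that(2)[OF kernel_vanishing_increments] .
qed (rule vanishing_increments_add vanishing_increments_scale; assumption)+

text \<open>The chain must not depend on \<open>f\<close>: the common stability constant then yields continuity in \<open>f\<close>.\<close>

lemma locally_uniform_causal_chain:
  assumes "f0 \<in> H"
  obtains Q n where "\<And>f. f \<in> H \<Longrightarrow> ip_dist H ip f f0 < 1 / (8 * L) \<Longrightarrow> causal_chain Q n f"
proof -
  \<comment> \<open>The constant 1/4 for \<open>f0\<close> leaves room for a perturbation: distance
    \<open>1 / (8 * L)\<close> adds another 1/4, so nearby \<open>f\<close> reach the 1/2 demanded
    by the chain.\<close>
  obtain \<delta> where \<delta>: "\<delta> > 0" "\<And>s t x y. s \<in> {t0..T} \<Longrightarrow> t \<in> {t0..T} \<Longrightarrow> \<bar>t - s\<bar> < \<delta> \<Longrightarrow>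
       norm (increment s t (f0 x - f0 y)) \<le> 1 / 4 * norm (x - y)"
    using vanishing_incrementsE[of f0 "1 / 4"] assms by (auto simp: vanishing_increments_eq)
  obtain n where n: "real n > (T - t0) / \<delta>" using reals_Archimedean2 by blast
  then have "n > 0" using t0_less_T \<delta>(1)
    by (metis diff_gt_0_iff_gt divide_pos_pos less_trans of_nat_0_less_iff)
  define \<tau> where "\<tau> i = t0 + real i * ((T - t0) / n)" for i
  have \<tau>_mem: "\<tau> i \<in> {t0..T}" if "i \<le> n" for i
  proof -
    have "real i * ((T - t0) / n) \<le> real n * ((T - t0) / n)"
      using that t0_less_T by (intro mult_right_mono) auto
    then show ?thesis using \<open>n > 0\<close> t0_less_T by (simp add: \<tau>_def)
  qed
  have \<tau>_step: "\<bar>\<tau> (Suc i) - \<tau> i\<bar> < \<delta>" "\<tau> i \<le> \<tau> (Suc i)" for i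
  proof -
    have "\<tau> (Suc i) - \<tau> i = (T - t0) / n" by (simp add: \<tau>_def distrib_right add_divide_distrib)
    moreover have "(T - t0) / n < \<delta>" using n \<delta>(1) \<open>n > 0\<close> by (simp add: field_simps)
    moreover have "0 \<le> (T - t0) / n" using t0_less_T by simp
    ultimately show "\<bar>\<tau> (Suc i) - \<tau> i\<bar> < \<delta>" "\<tau> i \<le> \<tau> (Suc i)" by linarith+
  qed
  have "causal_chain (\<lambda>i. \<pi> (\<tau> i)) n f" if f: "f \<in> H" "ip_dist H ip f f0 < 1 / (8 * L)" for f
  proof
    show "\<pi> (\<tau> 0) x = 0" for x by (simp add: \<tau>_def projection_t0)
    show "\<pi> (\<tau> n) x = x" for x using \<open>n > 0\<close> by (simp add: \<tau>_def projection_T)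
    fix i x
    show "norm (\<pi> (\<tau> i) x) \<le> norm x" if "i \<le> n"
      using projection_norm_le \<tau>_mem that by blast
    show "\<pi> (\<tau> i) (\<pi> (\<tau> i) x) = \<pi> (\<tau> i) x" if "i \<le> n"
      using projection_comp \<tau>_mem that by blast
    show "\<pi> (\<tau> i) (f x) = \<pi> (\<tau> i) (f (\<pi> (\<tau> i) x))" if "i \<le> n"
      using causal_H \<tau>_mem f(1) that by blast
    assume "i < n"
    then have i: "\<tau> i \<in> {t0..T}" "\<tau> (Suc i) \<in> {t0..T}" using \<tau>_mem by auto
    show "\<pi> (\<tau> i) (\<pi> (\<tau> (Suc i)) x) = \<pi> (\<tau> i) x"
      using projection_comp[OF i \<tau>_step(2)] .
    fix y
    have "2 * L * ip_dist H ip f f0 \<le> 1 / 4" using f(2) L_pos by (simp add: field_simps)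
    then have "2 * L * ip_dist H ip f f0 * norm (x - y) \<le> 1 / 4 * norm (x - y)"
      by (intro mult_right_mono) auto
    then show "norm (\<pi> (\<tau> (Suc i)) (f x - f y) - \<pi> (\<tau> i) (f x - f y)) \<le> norm (x - y) / 2"
      using increment_perturb[OF i f(1) assms, of x y] \<delta>(2)[OF i \<tau>_step(1), of x y]
      by (simp add: increment_def)
  qed
  then show thesis using that by blast
qed

section \<open>Machine property and joint continuity of stable states\<close>

lemma continuous_on_H:
  assumes "f \<in> H" shows "continuous_on UNIV f"
proof (rule lipschitz_on_continuous_on)
  show "(L * nrm f)-lipschitz_on UNIV f"
    using lipschitz_H[OF assms] L_pos nrm_nonneg[OF assms] by (auto intro!: lipschitz_onI simp: dist_norm)
qed

lemma dist_eval_le: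
  assumes "f \<in> H" "g \<in> H"
  shows "dist (f x) (g x) \<le> sqrt (norm (K x x)) * ip_dist H ip f g"
  using norm_eval_le[OF diff_mem[OF assms]] assms by (simp add: dist_norm ip_dist_eq_nrm)

lemma machine_H:
  assumes "f \<in> H" shows "machine TYPE('z) f"
proof -
  obtain Q n where "\<And>g. g \<in> H \<Longrightarrow> ip_dist H ip g f < 1 / (8 * L) \<Longrightarrow> causal_chain Q n g"
    using locally_uniform_causal_chain[OF assms] by blast
  then have "causal_chain Q n f" using assms L_pos by simp
  then show ?thesis
    using causal_chain.machine_causal_map continuous_on_H[OF assms] by blast
qed

text \<open>The comparison of \<open>g y\<close> with \<open>f x\<close> goes through
  \<open>g x\<close>: the first step uses the Lipschitz bound of \<open>g\<close>, the second the
  continuity of evaluation at \<open>x\<close>.\<close>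

lemma jointly_continuous_application: "jointly_continuous (norm_topology H ip) (\<lambda>f x. f x)"
  unfolding jointly_continuous_metric norm_topology_def
proof (intro ballI allI impI)
  fix f x and \<epsilon> :: real assume "f \<in> topspace M.mtopology" "\<epsilon> > 0"
  then have f: "f \<in> H" by simp
  define B where "B = sqrt (norm (K x x)) + 1"
  define A where "A = L * (nrm f + 1) + 1"
  have "B > 0" by (simp add: B_def add_nonneg_pos)
  have "A > 0" using L_pos nrm_nonneg[OF f] by (simp add: A_def add_nonneg_pos)
  \<comment> \<open>Radius at most 1 gives \<open>nrm g \<le> nrm f + 1\<close>, hence one Lipschitz
    constant below \<open>A\<close> for all \<open>g\<close> in the ball.\<close>
  let ?U = "M.mball f (min 1 (\<epsilon> / (2 * B)))" and ?V = "ball x (\<epsilon> / (2 * A))"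
  have "dist (g y) (f x) < \<epsilon>" if g: "g \<in> ?U" and y: "y \<in> ?V" for g y
  proof -
    have gH: "g \<in> H" and d1: "ip_dist H ip g f < 1" and dB: "ip_dist H ip g f < \<epsilon> / (2 * B)"
      using g by (auto simp: M.commute)
    have "nrm g \<le> nrm f + 1"
    proof -
      have "nrm h = ip_dist H ip h (\<lambda>x. 0)" if "h \<in> H" for h
        using that zero_mem by (simp add: ip_dist_eq_nrm)
      then show ?thesis using M.triangle[OF gH f zero_mem] d1 gH f by simp
    qed
    then have "L * nrm g * norm (y - x) \<le> A * norm (y - x)"
      using L_pos by (intro mult_right_mono) (auto simp: A_def intro: add_increasing2)
    moreover have "A * norm (y - x) < \<epsilon> / 2"
      using y \<open>A > 0\<close> by (simp add: dist_norm norm_minus_commute field_simps)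
    moreover have "dist (g y) (g x) \<le> L * nrm g * norm (y - x)"
      using lipschitz_H[OF gH] by (simp add: dist_norm)
    moreover have "dist (g x) (f x) \<le> B * ip_dist H ip g f"
      using dist_eval_le[OF gH f, of x] by (rule order_trans) (simp add: B_def mult_right_mono)
    moreover have "B * ip_dist H ip g f < \<epsilon> / 2"
      using dB \<open>B > 0\<close> by (simp add: field_simps)
    ultimately show ?thesis using dist_triangle[of "g y" "f x" "g x"] by linarith
  qed
  then show "\<exists>U V. openin M.mtopology U \<and> open V \<and> f \<in> U \<and> x \<in> V \<and>
      (\<forall>f'\<in>U. \<forall>x'\<in>V. dist (f' x') (f x) < \<epsilon>)"
    using f \<open>\<epsilon> > 0\<close> \<open>A > 0\<close> \<open>B > 0\<close> by (intro exI[of _ ?U] exI[of _ ?V]) auto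
qed

text \<open>The state \<open>x = h p m\<close> solves the equation of a nearby \<open>p'\<close> up
  to an error \<open>e\<close>, consisting of the change of the input and the change of the map at
  the fixed point \<open>x\<close>. Stability for \<open>p'\<close>, with the same \<open>n\<close>
  for all \<open>p'\<close> near \<open>p\<close>, bounds the distance of the states.\<close>

lemma jointly_continuous_stable_state:
  assumes g: "jointly_continuous (norm_topology H ip) g"
    and h: "\<And>p. p \<in> H \<Longrightarrow> is_stable_state euclidean p (g p) (h p)"
  shows "jointly_continuous (norm_topology H ip) h"
  unfolding jointly_continuous_metric norm_topology_def
proof (intro ballI allI impI)
  fix p m and \<epsilon> :: real assume "p \<in> topspace M.mtopology" "\<epsilon> > 0"
  then have p: "p \<in> H" by simp
  obtain Q n where chain: "\<And>f. f \<in> H \<Longrightarrow> ip_dist H ip f p < 1 / (8 * L) \<Longrightarrow> causal_chain Q n f"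
    using locally_uniform_causal_chain[OF p] by blast
  define x where "x = h p m"
  define B where "B = sqrt (norm (K x x)) + 1"
  define C :: real where "C = 4 * 2 ^ n"
  have "B > 0" by (simp add: B_def add_nonneg_pos)
  have "C > 0" by (simp add: C_def)
  \<comment> \<open>Both parts of \<open>e\<close> will be below \<eta>, and
    \<open>C * (2 * \<eta>)\<close> equals \<epsilon>.\<close>
  define \<eta> where "\<eta> = \<epsilon> / (2 * C)"
  have "\<eta> > 0" using \<open>\<epsilon> > 0\<close> \<open>C > 0\<close> by (simp add: \<eta>_def)
  obtain U V where UV: "openin M.mtopology U" "open V" "p \<in> U" "m \<in> V"
    and gUV: "\<And>p' m'. p' \<in> U \<Longrightarrow> m' \<in> V \<Longrightarrow> dist (g p' m') (g p m) < \<eta>"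
    using g[unfolded jointly_continuous_metric norm_topology_def, rule_format, of p \<eta> m] p \<open>\<eta> > 0\<close>
    by auto
  let ?U = "U \<inter> M.mball p (min (1 / (8 * L)) (\<eta> / B))"
  have "dist (h p' m') x < \<epsilon>" if p': "p' \<in> ?U" and m': "m' \<in> V" for p' m'
  proof -
    have p'H: "p' \<in> H" and near: "ip_dist H ip p' p < 1 / (8 * L)" and dB: "ip_dist H ip p' p < \<eta> / B"
      using p' by (auto simp: M.commute)
    define e where "e = (g p' m' - g p m) + (p' x - p x)"
    have 1: "h p' m' = g p' m' + p' (h p' m')" and 2: "x = g p m + p x"
      using h[OF p'H] h[OF p] by (auto simp: is_stable_state_def x_def)
    have "h p' m' - x = (g p' m' + p' (h p' m')) - (g p m + p x)"
      by (rule arg_cong2[where f = minus, OF 1 2])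
    also have "\<dots> = e + (p' (h p' m') - p' x)" by (simp add: e_def)
    finally have "h p' m' - x = e + (p' (h p' m') - p' x)" .
    then have "norm (h p' m' - x) \<le> C * norm e"
      unfolding C_def by (rule causal_chain.stability[OF chain[OF p'H near]])
    moreover have "norm e < 2 * \<eta>"
    proof -
      have "norm e \<le> dist (g p' m') (g p m) + dist (p' x) (p x)"
        unfolding e_def dist_norm by (rule norm_triangle_ineq)
      moreover have "dist (p' x) (p x) \<le> B * ip_dist H ip p' p"
        using dist_eval_le[OF p'H p, of x] by (rule order_trans) (simp add: B_def mult_right_mono)
      moreover have "B * ip_dist H ip p' p < \<eta>" using dB \<open>B > 0\<close> by (simp add: field_simps)
      moreover have "dist (g p' m') (g p m) < \<eta>" using gUV p' m' by blast
      ultimately show ?thesis by linarith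
    qed
    then have "C * norm e < \<epsilon>" using \<open>C > 0\<close> by (simp add: \<eta>_def field_simps)
    ultimately show ?thesis by (simp add: dist_norm)
  qed
  moreover have "openin M.mtopology ?U" using UV(1) by (intro openin_Int) auto
  moreover have "p \<in> ?U" using p UV(3) L_pos \<open>\<eta> > 0\<close> \<open>B > 0\<close> by simp
  ultimately show "\<exists>U V. openin M.mtopology U \<and> open V \<and> p \<in> U \<and> m \<in> V \<and>
      (\<forall>p'\<in>U. \<forall>m'\<in>V. dist (h p' m') (h p m) < \<epsilon>)"
    using UV(2,4) unfolding x_def by (intro exI[of _ ?U] exI[of _ V]) auto
qed

lemma parametric_machine_application:
  "parametric_machine TYPE('z) (norm_topology H ip) (\<lambda>f x. f x)"
proof -
  have top: "topspace (norm_topology H ip) = H" by (simp add: norm_topology_def)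
  show ?thesis
    unfolding parametric_machine_def top
  proof (intro conjI ballI allI impI)
    show "jointly_continuous (norm_topology H ip) (\<lambda>f x. f x)"
      by (rule jointly_continuous_application)
    show "machine TYPE('z) (\<lambda>x. f x)" if "f \<in> H" for f
      using machine_H[OF that] .
    fix g h
    assume "jointly_continuous (norm_topology H ip) g \<and>
      (\<forall>p\<in>H. is_stable_state euclidean (\<lambda>x. p x) (g p) (h p))"
    then show "jointly_continuous (norm_topology H ip) h"
      using jointly_continuous_stable_state by blast
  qed
qed

end

theorem theorem5:
  fixes t0 T :: real
    and F :: "real \<Rightarrow> 'x::{real_inner, complete_space} set"
    and \<pi> :: "real \<Rightarrow> 'x \<Rightarrow>\<^sub>L 'x"
    and K :: "'x \<Rightarrow> 'x \<Rightarrow> 'x \<Rightarrow>\<^sub>L 'x"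
    and H :: "('x \<Rightarrow> 'x) set"
    and ip :: "('x \<Rightarrow> 'x) \<Rightarrow> ('x \<Rightarrow> 'x) \<Rightarrow> real"
  assumes "t0 < T"
    and "continuous_filtration t0 T F \<pi>"
    and "operator_valued_kernel K"
    and "is_rkhs K H ip"
    and "\<exists>L>0. \<forall>x1 x2. norm (K x1 x1 + K x2 x2 - 2 *\<^sub>R K x1 x2) \<le> L\<^sup>2 * (norm (x1 - x2))\<^sup>2"
    and "\<forall>t\<in>{t0..T}. \<forall>x1 x2.
           K x1 x2 o\<^sub>L \<pi> t = \<pi> t o\<^sub>L K x1 x2 \<and>
           \<pi> t o\<^sub>L K x1 x2 = \<pi> t o\<^sub>L K (\<pi> t x1) (\<pi> t x2)"
  shows "parametric_machine TYPE('z) (norm_topology H ip) (\<lambda>f x. f x)"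
proof -
  obtain L where L: "L > 0"
    "\<And>x1 x2. norm (K x1 x1 + K x2 x2 - 2 *\<^sub>R K x1 x2) \<le> L\<^sup>2 * (norm (x1 - x2))\<^sup>2"
    using assms(5) by blast
  interpret causal_rkhs K H ip t0 T F \<pi> L
  proof unfold_locales
    fix t x z c assume "t \<in> {t0..T}"
    then have "K x z o\<^sub>L \<pi> t = \<pi> t o\<^sub>L K x z" "\<pi> t o\<^sub>L K x z = \<pi> t o\<^sub>L K (\<pi> t x) (\<pi> t z)"
      using assms(6) by blast+
    then show "K x z (\<pi> t c) = \<pi> t (K x z c)" "\<pi> t (K x z c) = \<pi> t (K (\<pi> t x) (\<pi> t z) c)"
      by (metis blinfun_apply_blinfun_compose)+
  qed (use assms(1,2,4) L in auto)
  show ?thesis by (rule parametric_machine_application)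
qed

end
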